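(* Let $\sigma:\mathbb{R}\to\mathbb{R}$ satisfy $0\le\frac{\sigma(a)-\sigma(b)}{a-b}\le1$ for all $a\neq b$, let $L\ge1$, $\mathbf x\in\mathbb{R}^d$, and for $i=1,\dots,L$ let $\mathbf W_i\in\mathbb{R}^{n_i\times m}$ with $\|\mathbf W_i\|_2\le1$, $\mathbf U_i\in\mathbb{R}^{n_i\times d}$, $\mathbf b_i\in\mathbb{R}^{n_i}$. Assume that $\|\mathbf W_i\|_2<1$ for at least one $i$. Let $\varphi_1,\dots,\varphi_L:\mathbb{R}^m\to\mathbb{R}\cup\{+\infty\}$ be proper convex functions such that $\operatorname{prox}_{\varphi_i}(\mathbf z)=\mathbf W_i^\top\sigma(\mathbf W_i\mathbf z+\mathbf U_i\mathbf x+\mathbf b_i)$ for all $\mathbf z\in\mathbb{R}^m$. For $\alpha\in(0,1]$ let $\widetilde{\mathbf z}^*(\alpha)=[\mathbf z_1^*(\alpha),\dots,\mathbf z_{L-1}^*(\alpha),\mathbf z_0^*(\alpha)]^\top\in\mathbb{R}^{mL}$ be the equilibrium point of $$\widetilde{\mathbf z}=\alpha\widetilde{\mathbf W}^\top\sigma(\widetilde{\mathbf W}\mathbf P\widetilde{\mathbf z}+\widetilde{\mathbf U}\mathbf x+\widetilde{\mathbf b})+(1-\alpha)\mathbf P\widetilde{\mathbf z}.$$ Then, as $\alpha\to0$, all the blocks $\mathbf z_l^*(\alpha)$, $l=0,\dots,L-1$, converge to one common limit, and this limit is the last entry $\mathbf y$ of the minimizer $(\mathbf x_1,\dots,\mathbf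 x_L,\mathbf y)$ of the optimization problem $$\min_{\mathbf x_1,\dots,\mathbf x_L,\mathbf y\in\mathbb{R}^m}\ \sum_{l=1}^L\left(\varphi_l(\mathbf x_l)+\frac12\|\mathbf x_l-\mathbf y\|^2\right).$$
   Context: $\sigma$ is applied element-wise. $\widetilde{\mathbf W}$ is the block diagonal matrix with diagonal blocks $\mathbf W_1,\dots,\mathbf W_L$; $\widetilde{\mathbf U}$ and $\widetilde{\mathbf b}$ are the vertical stackings of $\mathbf U_1,\dots,\mathbf U_L$ and $\mathbf b_1,\dots,\mathbf b_L$. $\mathbf P\in\mathbb{R}^{mL\times mL}$ is the block cyclic permutation: the first block of $\mathbf P\widetilde{\mathbf z}$ is the last block of $\widetilde{\mathbf z}$, and for $i\ge2$ the $i$-th block of $\mathbf P\widetilde{\mathbf z}$ is the $(i-1)$-th block of $\widetilde{\mathbf z}$. An equilibrium point of an equation $\widetilde{\mathbf z}=F(\widetilde{\mathbf z})$ is a solution of it. $\|\cdot\|$ is the Euclidean norm, $\|\cdot\|_2$ of a matrix the operator norm, and $\operatorname{prox}_h(\mathbf x)=\operatorname{argmin}_{\mathbf u}\{\frac12\|\mathbf u-\mathbf x\|^2+h(\mathbf u)\}$ for proper convex $h$. Under the stated assumptions on $\sigma$ and $\mathbf W_i$, functions $\varphi_i$ as described exist, for example $\varphi_i=\psi_i^*-\frac12\|\cdot\|^2$ with $\psi_i(\mathbf z)=\mathbf 1^\top\tilde\sigma(\mathbf W_i\mathbf z+\mathbf U_i\mathbf x+\mathbf b_i)$, $\tilde\sigma(a)=\int_0^a\sigma(t)\,dt$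 element-wise, and $\psi_i^*$ the convex conjugate. *)

theory Defs
  imports "HOL-Analysis.Analysis"
begin

text \<open>
  The number of rows of a layer varies with the layer, and stacked objects have index sets of
  the form of a disjoint union. Matrices are therefore functions \<open>'r \<Rightarrow> 'c \<Rightarrow> real\<close> used on explicit
  finite sets of row and column indices. The fixed spaces of dimensions \<open>m\<close> and \<open>d\<close> are
  \<open>real ^ 'm\<close> and \<open>real ^ 'd\<close>.
\<close>

definition mat_vec :: "'c set \<Rightarrow> ('r \<Rightarrow> 'c \<Rightarrow> real) \<Rightarrow> ('c \<Rightarrow> real) \<Rightarrow> 'r \<Rightarrow> real" where
  "mat_vec C A v r = (\<Sum>c\<in>C. A r c * v c)"

definition mat_transpose :: "('r \<Rightarrow> 'c \<Rightarrow> real) \<Rightarrow> 'c \<Rightarrow> 'r \<Rightarrow> real" where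
  "mat_transpose A c r = A r c"

text \<open>The supremum is over a nonempty set, bounded above whenever \<open>R\<close> and \<open>C\<close> are finite.\<close>

definition mat_opnorm :: "'r set \<Rightarrow> 'c set \<Rightarrow> ('r \<Rightarrow> 'c \<Rightarrow> real) \<Rightarrow> real" where
  "mat_opnorm R C A = (SUP v\<in>{v. L2_set v C \<le> 1}. L2_set (mat_vec C A v) R)"

text \<open>
  Layers are numbered \<open>1, \<dots>, L\<close>; layer \<open>i\<close> has \<open>n i\<close> rows. \<open>row_idx\<close> indexes the rows of the
  stacked matrices, \<open>blk_idx\<close> the coordinates of the stacked state vectors.
\<close>

definition row_idx :: "nat \<Rightarrow> (nat \<Rightarrow> nat) \<Rightarrow> (nat \<times> nat) set" where
  "row_idx L n = (SIGMA i:{1..L}. {1..n i})"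

definition blk_idx :: "nat \<Rightarrow> (nat \<times> 'm) set" where
  "blk_idx L = {1..L} \<times> UNIV"

definition block_diag :: "(nat \<Rightarrow> 'r \<Rightarrow> 'c \<Rightarrow> real) \<Rightarrow> nat \<times> 'r \<Rightarrow> nat \<times> 'c \<Rightarrow> real" where
  "block_diag W = (\<lambda>(i, k) (j, c). if i = j then W i k c else 0)"

definition vstack :: "(nat \<Rightarrow> 'r \<Rightarrow> 'a) \<Rightarrow> nat \<times> 'r \<Rightarrow> 'a" where
  "vstack B = (\<lambda>(i, k). B i k)"

definition cyclic_perm :: "nat \<Rightarrow> nat \<times> 'm \<Rightarrow> nat \<times> 'm \<Rightarrow> real" where
  "cyclic_perm L = (\<lambda>(i, c) (j, c').
     if j = (if i = 1 then L else i - 1) \<and> c' = c then 1 else 0)"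

lemma mat_vec_cyclic_perm:
  fixes z :: "nat \<times> 'm::finite \<Rightarrow> real"
  assumes "i \<in> {1..L}"
  shows "mat_vec (blk_idx L) (cyclic_perm L) z (i, c) = (if i = 1 then z (L, c) else z (i - 1, c))"
proof -
  let ?j = "if i = 1 then L else i - 1"
  have "mat_vec (blk_idx L) (cyclic_perm L) z (i, c)
      = (\<Sum>q\<in>blk_idx L. if q = (?j, c) then z q else 0)"
    unfolding mat_vec_def cyclic_perm_def by (intro sum.cong) (auto split: if_splits)
  also have "\<dots> = z (?j, c)"
    using assms by (subst sum.delta) (auto simp: blk_idx_def)
  finally show ?thesis by simp
qed

text \<open>
  The spaces of stacked vectors are sets of functions that are \<open>undefined\<close> outside the finite
  index set (\<open>PiE\<close>), so that uniqueness of an equilibrium is meaningful.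
\<close>

definition equilibrium ::
  "nat \<Rightarrow> (nat \<Rightarrow> nat) \<Rightarrow> (nat \<Rightarrow> nat \<Rightarrow> 'm \<Rightarrow> real) \<Rightarrow> (nat \<Rightarrow> nat \<Rightarrow> 'd \<Rightarrow> real) \<Rightarrow>
   (nat \<Rightarrow> nat \<Rightarrow> real) \<Rightarrow> (real \<Rightarrow> real) \<Rightarrow> real ^ 'd \<Rightarrow> real \<Rightarrow>
   (nat \<times> 'm::finite \<Rightarrow> real) \<Rightarrow> bool" where
  "equilibrium L n W U b \<sigma> x \<alpha> z \<longleftrightarrow>
     z \<in> blk_idx L \<rightarrow>\<^sub>E UNIV \<and>
     (let Pz = mat_vec (blk_idx L) (cyclic_perm L) z;
          h = (\<lambda>r. mat_vec (blk_idx L) (block_diag W) Pz r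
                 + mat_vec UNIV (vstack U) (($) x) r + vstack b r)
      in \<forall>p\<in>blk_idx L.
           z p = \<alpha> * mat_vec (row_idx L n) (mat_transpose (block_diag W)) (\<lambda>r. \<sigma> (h r)) p
                 + (1 - \<alpha>) * Pz p)"

text \<open>
  For a stacked state \<open>[z\<^sub>1, \<dots>, z\<^bsub>L-1\<^esub>, z\<^sub>0]\<close>, the block at position \<open>i < L\<close> is \<open>z\<^sub>i\<close> and the block
  at position \<open>L\<close> is \<open>z\<^sub>0\<close>.
\<close>

definition blk :: "(nat \<times> 'm::finite \<Rightarrow> real) \<Rightarrow> nat \<Rightarrow> real ^ 'm" where
  "blk z i = (\<chi> c. z (i, c))"

definition layer ::
  "nat \<Rightarrow> (nat \<Rightarrow> 'm \<Rightarrow> real) \<Rightarrow> (nat \<Rightarrow> 'd \<Rightarrow> real) \<Rightarrow> (nat \<Rightarrow> real) \<Rightarrow> (real \<Rightarrow> real) \<Rightarrow>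
   real ^ 'd \<Rightarrow> real ^ 'm \<Rightarrow> real ^ 'm::finite" where
  "layer n W U b \<sigma> x z =
     (\<chi> c. mat_vec {1..n} (mat_transpose W)
        (\<lambda>k. \<sigma> (mat_vec UNIV W (($) z) k + mat_vec UNIV U (($) x) k + b k)) c)"

definition proper_convex :: "('a::real_vector \<Rightarrow> ereal) \<Rightarrow> bool" where
  "proper_convex h \<longleftrightarrow>
     (\<forall>u. h u \<noteq> -\<infinity>) \<and> (\<exists>u. h u \<noteq> \<infinity>) \<and>
     (\<forall>u v t. 0 < t \<longrightarrow> t < 1 \<longrightarrow>
        h ((1 - t) *\<^sub>R u + t *\<^sub>R v) \<le> ereal (1 - t) * h u + ereal t * h v)"

text \<open>
  The set of all minimizers. For proper convex \<open>h\<close> it has at most one element, but it may be empty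
  (\<open>h\<close> need not be lower semicontinuous), so a proximal value \<open>p\<close> is asserted as
  \<open>prox h x = {p}\<close>.
\<close>

definition prox :: "('a::real_normed_vector \<Rightarrow> ereal) \<Rightarrow> 'a \<Rightarrow> 'a set" where
  "prox h x = {u. is_arg_min (\<lambda>u. ereal (1/2 * (norm (u - x))\<^sup>2) + h u) (\<lambda>_. True) u}"

definition objective ::
  "nat \<Rightarrow> (nat \<Rightarrow> 'a::real_normed_vector \<Rightarrow> ereal) \<Rightarrow> (nat \<Rightarrow> 'a) \<times> 'a \<Rightarrow> ereal" where
  "objective L \<phi> = (\<lambda>(xs, y). \<Sum>l=1..L. \<phi> l (xs l) + ereal (1/2 * (norm (xs l - y))\<^sup>2))"

definition minimizer ::
  "nat \<Rightarrow> (nat \<Rightarrow> 'a::real_normed_vector \<Rightarrow> ereal) \<Rightarrow> (nat \<Rightarrow> 'a) \<times> 'a \<Rightarrow> bool" where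
  "minimizer L \<phi> p \<longleftrightarrow> is_arg_min (objective L \<phi>) (\<lambda>p. p \<in> ({1..L} \<rightarrow>\<^sub>E UNIV) \<times> UNIV) p"

end

theory Submission
  imports Defs
begin

text \<open>
  Write \<open>T\<^sub>i\<close> for the \<open>i\<close>-th layer. Blockwise, the equilibrium equation says that \<open>z\<^sub>0\<close> is a fixed
  point of the composition \<open>F\<^sub>\<alpha>\<close> of the maps \<open>(1 - \<alpha>) I + \<alpha> T\<^sub>i\<close>. All \<open>T\<^sub>i\<close> are nonexpansive and one has a
  Lipschitz constant \<open>q < 1\<close>, so \<open>F\<^sub>\<alpha>\<close> has Lipschitz constant \<open>1 - \<alpha> (1 - q)\<close>, and the average of the
  \<open>T\<^sub>i\<close> has a unique fixed point \<open>y\<close>. Since \<open>F\<^sub>\<alpha> y = y + \<alpha> (\<Sum>i. T\<^sub>i y - y) + O(\<alpha>\<^sup>2) = y + O(\<alpha>\<^sup>2)\<close>, the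
  fixed point of \<open>F\<^sub>\<alpha>\<close> is within \<open>O(\<alpha>)\<close> of \<open>y\<close>. On the other hand, \<open>y - T\<^sub>i y\<close> is a subgradient of
  \<open>\<phi>\<^sub>i\<close> at \<open>T\<^sub>i y\<close>, so \<open>\<Sum>i. T\<^sub>i y - y = 0\<close> is the optimality condition of the minimization problem.
\<close>

section \<open>Compositions of relaxed nonexpansive maps\<close>

text \<open>Maps are numbered from 1, so that started at block \<open>L\<close> of an equilibrium
  (that is, at \<open>z\<close>-block 0), value \<open>k\<close> of the orbit is block
  \<open>k\<close>, and the cycle closes up exactly when the start is a fixed point of the map to
  value \<open>L\<close>.\<close>

primrec relaxed_orbit :: "(nat \<Rightarrow> 'a \<Rightarrow> 'a) \<Rightarrow> real \<Rightarrow> 'a \<Rightarrow> nat \<Rightarrow> 'a::real_normed_vector" where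
  "relaxed_orbit T \<alpha> y 0 = y"
| "relaxed_orbit T \<alpha> y (Suc k) =
     (1 - \<alpha>) *\<^sub>R relaxed_orbit T \<alpha> y k + \<alpha> *\<^sub>R T (Suc k) (relaxed_orbit T \<alpha> y k)"

lemma relaxed_lipschitz:
  fixes T :: "'a \<Rightarrow> 'a::real_normed_vector"
  assumes "0 \<le> \<alpha>" "\<alpha> \<le> 1" "dist (T u) (T v) \<le> q * dist u v"
  shows "dist ((1 - \<alpha>) *\<^sub>R u + \<alpha> *\<^sub>R T u) ((1 - \<alpha>) *\<^sub>R v + \<alpha> *\<^sub>R T v) \<le> (1 - \<alpha> * (1 - q)) * dist u v"
proof -
  have "dist ((1 - \<alpha>) *\<^sub>R u + \<alpha> *\<^sub>R T u) ((1 - \<alpha>) *\<^sub>R v + \<alpha> *\<^sub>R T v)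
      = norm ((1 - \<alpha>) *\<^sub>R (u - v) + \<alpha> *\<^sub>R (T u - T v))"
    by (simp add: dist_norm algebra_simps)
  also have "\<dots> \<le> (1 - \<alpha>) * dist u v + \<alpha> * dist (T u) (T v)"
    using assms(1,2) by (intro norm_triangle_le) (simp add: dist_norm)
  also have "\<dots> \<le> (1 - \<alpha>) * dist u v + \<alpha> * (q * dist u v)"
    using assms by (intro add_left_mono mult_left_mono) auto
  finally show ?thesis by (simp add: algebra_simps)
qed

lemma relaxed_orbit_nonexpansive:
  fixes T :: "nat \<Rightarrow> 'a \<Rightarrow> 'a::real_normed_vector"
  assumes "0 \<le> \<alpha>" "\<alpha> \<le> 1"
    and "\<And>i u v. i \<in> {1..k} \<Longrightarrow> dist (T i u) (T i v) \<le> dist u v"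
  shows "dist (relaxed_orbit T \<alpha> u k) (relaxed_orbit T \<alpha> v k) \<le> dist u v"
  using assms(3)
proof (induction k)
  case (Suc k)
  have "dist (relaxed_orbit T \<alpha> u (Suc k)) (relaxed_orbit T \<alpha> v (Suc k))
      \<le> dist (relaxed_orbit T \<alpha> u k) (relaxed_orbit T \<alpha> v k)"
    \<comment> \<open>With \<open>q = 1\<close> the factor \<open>1 - \<alpha> * (1 - q)\<close> is
      1.\<close>
    using relaxed_lipschitz[OF assms(1,2), of "T (Suc k)" _ _ 1] Suc.prems by simp
  also have "\<dots> \<le> dist u v" using Suc by simp
  finally show ?case .
qed simp

text \<open>Step \<open>j\<close> alone supplies the factor below 1; the steps before and after it
  do not increase distances.\<close>

lemma relaxed_orbit_contraction:
  fixes T :: "nat \<Rightarrow> 'a \<Rightarrow> 'a::real_normed_vector"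
  assumes \<alpha>: "0 \<le> \<alpha>" "\<alpha> \<le> 1" and q: "0 \<le> q"
    and "\<And>i u v. i \<in> {1..k} \<Longrightarrow> dist (T i u) (T i v) \<le> dist u v"
    and j: "\<And>u v. dist (T j u) (T j v) \<le> q * dist u v" and "j \<in> {1..k}"
  shows "dist (relaxed_orbit T \<alpha> u k) (relaxed_orbit T \<alpha> v k) \<le> (1 - \<alpha> * (1 - q)) * dist u v"
  using assms(4,6)
proof (induction k)
  case (Suc k)
  let ?d = "\<lambda>k. dist (relaxed_orbit T \<alpha> u k) (relaxed_orbit T \<alpha> v k)"
  show ?case
  proof (cases "j = Suc k")
    case True
    \<comment> \<open>The factor must be nonnegative to be multiplied with the nonexpansive bound
      for the first \<open>k\<close> steps.\<close>
    have "\<alpha> * (1 - q) \<le> \<alpha> * 1" using \<alpha> q by (intro mult_left_mono) auto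
    with \<alpha> have nn: "0 \<le> 1 - \<alpha> * (1 - q)" by simp
    have "?d (Suc k) \<le> (1 - \<alpha> * (1 - q)) * ?d k"
      using relaxed_lipschitz[OF \<alpha>, of "T (Suc k)"] j True by simp
    also have "\<dots> \<le> (1 - \<alpha> * (1 - q)) * dist u v"
      using Suc.prems nn by (intro mult_left_mono relaxed_orbit_nonexpansive \<alpha>) auto
    finally show ?thesis .
  next
    case False
    have "?d (Suc k) \<le> ?d k"
      using relaxed_lipschitz[OF \<alpha>, of "T (Suc k)" _ _ 1] Suc.prems by simp
    also have "\<dots> \<le> (1 - \<alpha> * (1 - q)) * dist u v" using Suc False by auto
    finally show ?thesis .
  qed
qed simp

text \<open>The reference point \<open>v\<close> stays fixed while the orbit moves: each relaxed map
  is nonexpansive and shifts \<open>v\<close> itself by only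
  \<open>\<alpha> * norm (T i v - v)\<close>. With \<open>v = y\<close> this controls orbits started
  at \<open>y\<close> as well as those started at the fixed points.\<close>

lemma relaxed_orbit_displacement:
  fixes T :: "nat \<Rightarrow> 'a \<Rightarrow> 'a::real_normed_vector"
  assumes \<alpha>: "0 \<le> \<alpha>" "\<alpha> \<le> 1"
    and "\<And>i u v. i \<in> {1..k} \<Longrightarrow> dist (T i u) (T i v) \<le> dist u v"
  shows "dist (relaxed_orbit T \<alpha> u k) v \<le> dist u v + \<alpha> * (\<Sum>i=1..k. norm (T i v - v))"
  using assms(3)
proof (induction k)
  case (Suc k)
  let ?u = "relaxed_orbit T \<alpha> u k" and ?G = "\<lambda>w. (1 - \<alpha>) *\<^sub>R w + \<alpha> *\<^sub>R T (Suc k) w"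
  have "dist (?G ?u) v \<le> dist (?G ?u) (?G v) + dist (?G v) v"
    by (rule dist_triangle)
  also have "dist (?G ?u) (?G v) \<le> dist ?u v"
    using relaxed_lipschitz[OF \<alpha>, of "T (Suc k)" ?u v 1] Suc.prems by simp
  also have "?G v - v = \<alpha> *\<^sub>R (T (Suc k) v - v)"
    by (simp add: algebra_simps)
  then have "dist (?G v) v = \<alpha> * norm (T (Suc k) v - v)"
    using \<alpha> by (simp add: dist_norm)
  finally show ?case using Suc by (simp add: algebra_simps)
qed simp

text \<open>Each step evaluates its map at a point O(\<alpha>) away from \<open>y\<close>, and its
  own weight \<alpha> makes the resulting error quadratic. The constant is uniform in
  \<alpha>.\<close>

lemma relaxed_orbit_expansion:
  fixes T :: "nat \<Rightarrow> 'a \<Rightarrow> 'a::real_normed_vector"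
  assumes "\<And>i u v. i \<in> {1..k} \<Longrightarrow> dist (T i u) (T i v) \<le> dist u v"
  shows "\<exists>C\<ge>0. \<forall>\<alpha>\<in>{0..1}.
    norm (relaxed_orbit T \<alpha> y k - y - \<alpha> *\<^sub>R (\<Sum>i=1..k. T i y - y)) \<le> C * \<alpha>\<^sup>2"
  using assms
proof (induction k)
  case (Suc k)
  define D where "D = (\<Sum>i=1..k. norm (T i y - y))"
  have D: "0 \<le> D" unfolding D_def by (intro sum_nonneg) auto
  from Suc obtain C where C: "C \<ge> 0"
    "\<And>\<alpha>. \<alpha> \<in> {0..1} \<Longrightarrow>
       norm (relaxed_orbit T \<alpha> y k - y - \<alpha> *\<^sub>R (\<Sum>i=1..k. T i y - y)) \<le> C * \<alpha>\<^sup>2"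
    by auto
  \<comment> \<open>The new error is \<alpha> times the change of \<open>T (Suc k) - id\<close>
    between \<open>y\<close> and the orbit point. The orbit has moved by at most
    \<open>\<alpha> * D\<close>, and so has its image, which accounts for
    \<open>2 * D\<close>.\<close>
  have "norm (relaxed_orbit T \<alpha> y (Suc k) - y - \<alpha> *\<^sub>R (\<Sum>i=1..Suc k. T i y - y))
      \<le> (C + 2 * D) * \<alpha>\<^sup>2" if \<alpha>: "\<alpha> \<in> {0..1}" for \<alpha>
  proof -
    let ?o = "relaxed_orbit T \<alpha> y k"
    let ?e = "?o - y - \<alpha> *\<^sub>R (\<Sum>i=1..k. T i y - y)"
    have d: "norm (?o - y) \<le> \<alpha> * D"
      using relaxed_orbit_displacement[of \<alpha> k T y y] \<alpha> Suc.prems by (simp add: D_def dist_norm)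
    have "relaxed_orbit T \<alpha> y (Suc k) - y - \<alpha> *\<^sub>R (\<Sum>i=1..Suc k. T i y - y)
        = ?e + \<alpha> *\<^sub>R ((T (Suc k) ?o - T (Suc k) y) - (?o - y))"
      by (simp add: algebra_simps)
    also have "norm \<dots> \<le> C * \<alpha>\<^sup>2 + \<alpha> * (norm (T (Suc k) ?o - T (Suc k) y) + norm (?o - y))"
      using \<alpha> C(2)[OF \<alpha>]
      by (intro norm_triangle_le add_mono) (auto intro!: mult_left_mono norm_triangle_ineq4)
    also have "\<dots> \<le> C * \<alpha>\<^sup>2 + \<alpha> * (\<alpha> * D + \<alpha> * D)"
      using \<alpha> d Suc.prems[of "Suc k" ?o y]
      by (intro add_left_mono mult_left_mono add_mono) (auto simp: dist_norm)
    also have "\<dots> = (C + 2 * D) * \<alpha>\<^sup>2"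
      by (simp add: algebra_simps power2_eq_square)
    finally show ?thesis .
  qed
  then show ?case using C(1) D by (intro exI[of _ "C + 2 * D"]) auto
qed (auto intro: exI[of _ 0])

lemma relaxed_orbit_fixed_point:
  fixes T :: "nat \<Rightarrow> 'a \<Rightarrow> 'a::banach"
  assumes \<alpha>: "0 < \<alpha>" "\<alpha> \<le> 1" and q: "0 \<le> q" "q < 1"
    and ne: "\<And>i u v. i \<in> {1..L} \<Longrightarrow> dist (T i u) (T i v) \<le> dist u v"
    and j: "\<And>u v. dist (T j u) (T j v) \<le> q * dist u v" "j \<in> {1..L}"
  shows "\<exists>!u. relaxed_orbit T \<alpha> u L = u"
proof (rule banach_fix_type[of "1 - \<alpha> * (1 - q)"])
  have "\<alpha> * (1 - q) \<le> 1 * 1" using \<alpha> q by (intro mult_mono) auto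
  then show "0 \<le> 1 - \<alpha> * (1 - q)" by simp
  show "1 - \<alpha> * (1 - q) < 1" using \<alpha> q by simp
  show "\<forall>u v. dist (relaxed_orbit T \<alpha> u L) (relaxed_orbit T \<alpha> v L) \<le> (1 - \<alpha> * (1 - q)) * dist u v"
    using relaxed_orbit_contraction[of \<alpha> q L T j] \<alpha> q ne j by auto
qed

text \<open>The defect of \<open>y\<close> under the full cycle is O(\<alpha>^2), while the
  contraction gap is only \<open>\<alpha> * (1 - q)\<close>; their quotient still tends to 0.
  Intermediate states follow since each lies O(\<alpha>) further away at most.\<close>

lemma relaxed_orbit_fixed_point_tendsto:
  fixes T :: "nat \<Rightarrow> 'a \<Rightarrow> 'a::real_normed_vector"
  assumes q: "0 \<le> q" "q < 1"
    and ne: "\<And>i u v. i \<in> {1..L} \<Longrightarrow> dist (T i u) (T i v) \<le> dist u v"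
    and j: "\<And>u v. dist (T j u) (T j v) \<le> q * dist u v" "j \<in> {1..L}"
    and y: "(\<Sum>i=1..L. T i y - y) = 0"
    and u: "\<And>\<alpha>. \<alpha> \<in> {0<..1} \<Longrightarrow> relaxed_orbit T \<alpha> (u \<alpha>) L = u \<alpha>"
    and k: "k \<le> L"
  shows "((\<lambda>\<alpha>. relaxed_orbit T \<alpha> (u \<alpha>) k) \<longlongrightarrow> y) (at_right 0)"
proof -
  define D where "D = (\<Sum>i=1..k. norm (T i y - y))"
  obtain C where C: "C \<ge> 0"
    "\<And>\<alpha>. \<alpha> \<in> {0..1} \<Longrightarrow> norm (relaxed_orbit T \<alpha> y L - y) \<le> C * \<alpha>\<^sup>2"
    using relaxed_orbit_expansion[of L T y, OF ne] unfolding y by auto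
  have bound: "dist (relaxed_orbit T \<alpha> (u \<alpha>) k) y \<le> \<alpha> * (C / (1 - q) + D)"
    if \<alpha>: "\<alpha> \<in> {0<..1}" for \<alpha>
  proof -
    have "dist (u \<alpha>) y \<le> dist (relaxed_orbit T \<alpha> (u \<alpha>) L) (relaxed_orbit T \<alpha> y L)
        + dist (relaxed_orbit T \<alpha> y L) y"
      using u[OF \<alpha>] dist_triangle by metis
    also have "\<dots> \<le> (1 - \<alpha> * (1 - q)) * dist (u \<alpha>) y + C * \<alpha>\<^sup>2"
      using \<alpha> C(2)[of \<alpha>]
      by (intro add_mono relaxed_orbit_contraction[of \<alpha> q L T j, OF _ _ q(1) ne j]) (auto simp: dist_norm)
    \<comment> \<open>The distance term on the right is absorbed into the left side, leaving the
      gap; one factor \<alpha> then cancels.\<close>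
    finally have "\<alpha> * ((1 - q) * dist (u \<alpha>) y) \<le> \<alpha> * (C * \<alpha>)"
      by (simp add: algebra_simps power2_eq_square)
    then have "(1 - q) * dist (u \<alpha>) y \<le> C * \<alpha>" using \<alpha> by simp
    then have "dist (u \<alpha>) y \<le> \<alpha> * (C / (1 - q))" using q by (simp add: field_simps)
    moreover have "dist (relaxed_orbit T \<alpha> (u \<alpha>) k) y \<le> dist (u \<alpha>) y + \<alpha> * D"
      unfolding D_def using \<alpha> k ne by (intro relaxed_orbit_displacement) auto
    ultimately show ?thesis by (simp add: algebra_simps)
  qed
  show ?thesis
  proof (rule tendsto_dist_iff[THEN iffD2], rule tendsto_sandwich[where f = "\<lambda>_. 0"])
    show "((\<lambda>\<alpha>. \<alpha> * (C / (1 - q) + D)) \<longlongrightarrow> 0) (at_right 0)"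
      by (auto intro!: tendsto_eq_intros)
    show "\<forall>\<^sub>F \<alpha> in at_right 0. dist (relaxed_orbit T \<alpha> (u \<alpha>) k) y \<le> \<alpha> * (C / (1 - q) + D)"
      using bound by (intro eventually_at_rightI[of 0 1]) auto
  qed auto
qed

text \<open>The zeros are the fixed points of the mean of the maps, to which Banach's theorem
  applies: one contracting summand makes the mean a contraction.\<close>

lemma average_fixed_point:
  fixes T :: "nat \<Rightarrow> 'a \<Rightarrow> 'a::banach"
  assumes q: "0 \<le> q" "q < 1"
    and ne: "\<And>i u v. i \<in> {1..L} \<Longrightarrow> dist (T i u) (T i v) \<le> dist u v"
    and j: "\<And>u v. dist (T j u) (T j v) \<le> q * dist u v" "j \<in> {1..L}"
  shows "\<exists>!y. (\<Sum>i=1..L. T i y - y) = 0"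
proof -
  have L: "real L > 0" using j(2) by auto
  let ?A = "\<lambda>y. (\<Sum>i=1..L. T i y) /\<^sub>R real L"
  have "dist (?A u) (?A v) \<le> ((real L - 1 + q) / real L) * dist u v" for u v
  proof -
    have "norm (\<Sum>i=1..L. T i u - T i v) \<le> (\<Sum>i=1..L. dist (T i u) (T i v))"
      unfolding dist_norm by (rule norm_sum)
    \<comment> \<open>Summand \<open>j\<close> contributes \<open>q\<close> and the remaining
      \<open>L - 1\<close> contribute 1 each; dividing by \<open>L\<close> gives a constant below
      1.\<close>
    also have "\<dots> \<le> (\<Sum>i=1..L. (if i = j then q else 1) * dist u v)"
      using ne j(1) by (intro sum_mono) auto
    also have "\<dots> = (\<Sum>i=1..L. if i = j then q else 1) * dist u v"
      by (simp add: sum_distrib_right)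
    also have "(\<Sum>i=1..L. if i = j then q else 1) = real L - 1 + q"
      using j(2) by (subst sum.remove[of _ j]) (auto simp: of_nat_diff)
    finally have "norm (\<Sum>i=1..L. T i u - T i v) \<le> (real L - 1 + q) * dist u v" .
    moreover have "?A u - ?A v = (\<Sum>i=1..L. T i u - T i v) /\<^sub>R real L"
      by (simp add: sum_subtractf scaleR_diff_right)
    ultimately show ?thesis
      using L by (simp add: dist_norm divide_inverse mult.commute mult_left_mono)
  qed
  then have "\<exists>!y. ?A y = y"
    using q L by (intro banach_fix_type[of "(real L - 1 + q) / real L"]) (auto simp: field_simps)
  moreover have "?A y = y \<longleftrightarrow> (\<Sum>i=1..L. T i y - y) = 0" for y
  proof -
    have "(\<Sum>i=1..L. T i y - y) = real L *\<^sub>R (?A y - y)"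
      using L by (simp add: sum_subtractf scaleR_diff_right sum_constant_scaleR)
    then show ?thesis using L by simp
  qed
  ultimately show ?thesis by simp
qed

section \<open>Proximal points and the minimization problem\<close>

text \<open>A point where \<open>h\<close> is finite has a finite proximal objective, so the
  minimizer \<open>p\<close> cannot have an infinite one.\<close>

lemma prox_finite:
  assumes "proper_convex h" "p \<in> prox h z"
  shows "\<bar>h p\<bar> \<noteq> \<infinity>"
proof -
  obtain v where v: "h v \<noteq> \<infinity>" using assms(1) by (auto simp: proper_convex_def)
  have "\<not> ereal (1/2 * (norm (v - z))\<^sup>2) + h v < ereal (1/2 * (norm (p - z))\<^sup>2) + h p"
    using assms(2) by (auto simp: prox_def is_arg_min_def)
  with v have "h p \<noteq> \<infinity>" by (cases "h v") auto
  moreover have "h p \<noteq> -\<infinity>" using assms(1) by (auto simp: proper_convex_def)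
  ultimately show ?thesis by auto
qed

text \<open>Fermat's rule for the proximal objective: \<open>p\<close> is compared with points on
  the segment towards \<open>u\<close>, and the comparison is differentiated at
  \<open>p\<close>.\<close>

lemma prox_subgradient:
  fixes h :: "'a::real_inner \<Rightarrow> ereal"
  assumes h: "proper_convex h" and p: "p \<in> prox h z"
  shows "h p + ereal ((z - p) \<bullet> (u - p)) \<le> h u"
proof (cases "h u = \<infinity>")
  case False
  obtain c where c: "h p = ereal c" using prox_finite[OF h p] by auto
  obtain a where a: "h u = ereal a" using False h by (cases "h u") (auto simp: proper_convex_def)
  \<comment> \<open>This is the difference quotient along the segment, with \<open>h\<close> bounded
    by its chord. The last term comes from the expanded square and vanishes as \<open>t\<close>
    tends to 0.\<close>
  have "0 \<le> (p - z) \<bullet> (u - p) + (a - c) + t * ((norm (u - p))\<^sup>2 / 2)" if t: "0 < t" "t < 1" for t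
  proof -
    let ?w = "(1 - t) *\<^sub>R p + t *\<^sub>R u"
    have "h ?w \<le> ereal ((1 - t) * c + t * a)"
      using h t unfolding proper_convex_def by (metis a c plus_ereal.simps(1) times_ereal.simps(1))
    then have "ereal (1/2 * (norm (?w - z))\<^sup>2) + h ?w
        \<le> ereal (1/2 * (norm (?w - z))\<^sup>2 + ((1 - t) * c + t * a))"
      by (metis add_left_mono plus_ereal.simps(1))
    moreover have "ereal (1/2 * (norm (p - z))\<^sup>2) + h p \<le> ereal (1/2 * (norm (?w - z))\<^sup>2) + h ?w"
      using p by (auto simp: prox_def is_arg_min_def not_less)
    ultimately have "ereal (1/2 * (norm (p - z))\<^sup>2 + c)
        \<le> ereal (1/2 * (norm (?w - z))\<^sup>2 + ((1 - t) * c + t * a))"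
      using order_trans unfolding c plus_ereal.simps by blast
    moreover have "?w - z = (p - z) + t *\<^sub>R (u - p)" by (simp add: algebra_simps)
    then have "(norm (?w - z))\<^sup>2
        = (norm (p - z))\<^sup>2 + 2 * t * ((p - z) \<bullet> (u - p)) + t\<^sup>2 * (norm (u - p))\<^sup>2"
      by (simp only: power2_norm_eq_inner)
        (simp add: inner_add_left inner_add_right inner_commute power2_eq_square algebra_simps)
    ultimately have "0 \<le> t * ((p - z) \<bullet> (u - p) + (a - c) + t * ((norm (u - p))\<^sup>2 / 2))"
      by (simp add: algebra_simps power2_eq_square)
    then show ?thesis using t by (simp add: zero_le_mult_iff)
  qed
  then have "\<forall>\<^sub>F t in at_right 0.
      0 \<le> (p - z) \<bullet> (u - p) + (a - c) + t * ((norm (u - p))\<^sup>2 / 2)"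
    by (intro eventually_at_rightI[of 0 1]) auto
  moreover have "((\<lambda>t. (p - z) \<bullet> (u - p) + (a - c) + t * ((norm (u - p))\<^sup>2 / 2))
      \<longlongrightarrow> (p - z) \<bullet> (u - p) + (a - c)) (at_right 0)"
    by (auto intro!: tendsto_eq_intros)
  ultimately have "0 \<le> (p - z) \<bullet> (u - p) + (a - c)"
    by (intro tendsto_lowerbound[of _ _ "at_right (0::real)"]) auto
  then show ?thesis by (simp add: a c inner_diff_left)
qed simp

text \<open>The subgradient inequality combined with an exact expansion of the square. The coupling
  term is strongly convex only in \<open>u - v\<close>, so the quadratic surplus sees only the
  deviation of \<open>u - v\<close> from \<open>p - y\<close>.\<close>

lemma prox_growth:
  fixes h :: "'a::real_inner \<Rightarrow> ereal"
  assumes "proper_convex h" "p \<in> prox h y"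
  shows "(h p + ereal (1/2 * (norm (p - y))\<^sup>2))
      + ereal ((y - p) \<bullet> (v - y) + 1/2 * (norm (u - v - (p - y)))\<^sup>2)
    \<le> h u + ereal (1/2 * (norm (u - v))\<^sup>2)"
proof -
  have "1/2 * (norm (p - y))\<^sup>2 + ((y - p) \<bullet> (v - y) + 1/2 * (norm (u - v - (p - y)))\<^sup>2)
      = (y - p) \<bullet> (u - p) + 1/2 * (norm (u - v))\<^sup>2"
    by (simp add: power2_norm_eq_inner inner_diff_left inner_diff_right inner_commute algebra_simps)
  then have "(h p + ereal (1/2 * (norm (p - y))\<^sup>2))
      + ereal ((y - p) \<bullet> (v - y) + 1/2 * (norm (u - v - (p - y)))\<^sup>2)
    = (h p + ereal ((y - p) \<bullet> (u - p))) + ereal (1/2 * (norm (u - v))\<^sup>2)"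
    by (simp only: add.assoc plus_ereal.simps)
  also have "\<dots> \<le> h u + ereal (1/2 * (norm (u - v))\<^sup>2)"
    by (intro add_right_mono prox_subgradient assms)
  finally show ?thesis .
qed

text \<open>In the sum over the layers, the linear terms merge into one inner product. It vanishes
  either when the residuals \<open>y - ps l\<close> sum to 0 or when \<open>v = y\<close>; both
  cases are used below.\<close>

lemma objective_growth:
  fixes \<phi> :: "nat \<Rightarrow> 'a::real_inner \<Rightarrow> ereal"
  assumes "\<And>l. l \<in> {1..L} \<Longrightarrow> proper_convex (\<phi> l)" "\<And>l. l \<in> {1..L} \<Longrightarrow> ps l \<in> prox (\<phi> l) y"
  shows "objective L \<phi> (ps, y)
      + ereal ((\<Sum>l=1..L. y - ps l) \<bullet> (v - y) + 1/2 * (\<Sum>l=1..L. (norm (xs l - v - (ps l - y)))\<^sup>2))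
    \<le> objective L \<phi> (xs, v)"
proof -
  have "(\<Sum>l=1..L. (\<phi> l (ps l) + ereal (1/2 * (norm (ps l - y))\<^sup>2))
      + ereal ((y - ps l) \<bullet> (v - y) + 1/2 * (norm (xs l - v - (ps l - y)))\<^sup>2))
    \<le> (\<Sum>l=1..L. \<phi> l (xs l) + ereal (1/2 * (norm (xs l - v))\<^sup>2))"
    using assms by (intro sum_mono prox_growth) auto
  then show ?thesis
    by (simp add: objective_def sum.distrib inner_sum_left sum_distrib_left
        flip: sum_ereal plus_ereal.simps)
qed

lemma objective_finite:
  assumes "\<And>l. l \<in> {1..L} \<Longrightarrow> proper_convex (\<phi> l)" "\<And>l. l \<in> {1..L} \<Longrightarrow> ps l \<in> prox (\<phi> l) y"
  shows "\<bar>objective L \<phi> (ps, y)\<bar> \<noteq> \<infinity>"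
proof -
  have "\<bar>\<phi> l (ps l) + ereal (1/2 * (norm (ps l - y))\<^sup>2)\<bar> \<noteq> \<infinity>" if l: "l \<in> {1..L}" for l
  proof -
    obtain c where "\<phi> l (ps l) = ereal c"
      using prox_finite[OF assms(1)[OF l] assms(2)[OF l]] by (cases "\<phi> l (ps l)") simp_all
    then show ?thesis by simp
  qed
  then have "\<not> (\<exists>l\<in>{1..L}. \<bar>\<phi> l (ps l) + ereal (1/2 * (norm (ps l - y))\<^sup>2)\<bar> = \<infinity>)"
    by (intro notI) (elim bexE, rule notE)
  then show ?thesis unfolding objective_def prod.case sum_Inf by (simp only: simp_thms)
qed

text \<open>The vanishing sum is the optimality condition in \<open>y\<close>, so growth makes the
  candidate minimal. The surplus is blind to a common shift of all variables, so uniqueness also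
  relies on \<open>y\<close> being the only zero.\<close>

lemma minimizer_iff:
  fixes \<phi> :: "nat \<Rightarrow> 'a::real_inner \<Rightarrow> ereal"
  assumes pc: "\<And>l. l \<in> {1..L} \<Longrightarrow> proper_convex (\<phi> l)"
    and T: "\<And>l z. l \<in> {1..L} \<Longrightarrow> T l z \<in> prox (\<phi> l) z"
    and y: "(\<Sum>l=1..L. T l y - y) = 0"
    and y_unique: "\<And>v. (\<Sum>l=1..L. T l v - v) = 0 \<Longrightarrow> v = y"
  shows "minimizer L \<phi> p \<longleftrightarrow> p = (\<lambda>l\<in>{1..L}. T l y, y)"
proof -
  \<comment> \<open>Restriction to \<open>{1..L}\<close> puts \<open>ps v\<close> in the extensional
    function space over which \<open>minimizer\<close> ranges.\<close>
  define ps where "ps v = (\<lambda>l\<in>{1..L}. T l v)" for v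
  have prox: "ps v l \<in> prox (\<phi> l) v" if "l \<in> {1..L}" for v l
    using T that by (simp add: ps_def)
  have fin: "\<bar>objective L \<phi> (ps v, v)\<bar> \<noteq> \<infinity>" for v
    by (rule objective_finite[OF pc prox])
  have y0: "(\<Sum>l=1..L. y - ps y l) = 0"
    using y by (simp add: ps_def sum_subtractf)
  have growth: "objective L \<phi> (ps y, y)
      + ereal (1/2 * (\<Sum>l=1..L. (norm (xs l - v - (ps y l - y)))\<^sup>2)) \<le> objective L \<phi> (xs, v)" for xs v
    using objective_growth[where \<phi> = \<phi> and L = L and ps = "ps y" and y = y and v = v and xs = xs,
        OF pc prox] unfolding y0 by simp
  have zero: "\<forall>l\<in>{1..L}. f l = 0"
    if "objective L \<phi> (ps w, w) + ereal (1/2 * (\<Sum>l=1..L. (norm (f l :: 'a))\<^sup>2)) \<le> objective L \<phi> (ps w, w)"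
    for f w
  proof -
    \<comment> \<open>The objective value is finite and can be cancelled.\<close>
    have "(\<Sum>l=1..L. (norm (f l))\<^sup>2) \<le> 0"
      using that fin[of w] by (cases "objective L \<phi> (ps w, w)") auto
    then have "(\<Sum>l=1..L. (norm (f l))\<^sup>2) = 0" by (intro antisym sum_nonneg) auto
    then show ?thesis by (subst (asm) sum_nonneg_eq_0_iff) auto
  qed
  have "minimizer L \<phi> (ps y, y)"
  proof -
    have "objective L \<phi> (ps y, y) \<le> objective L \<phi> (xs, v)" for xs v
    proof -
      have "objective L \<phi> (ps y, y) + 0 \<le> objective L \<phi> (ps y, y)
          + ereal (1/2 * (\<Sum>l=1..L. (norm (xs l - v - (ps y l - y)))\<^sup>2))"
        by (intro add_left_mono) (simp add: sum_nonneg)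
      with growth[of xs v] show ?thesis by simp
    qed
    then show ?thesis by (auto simp: minimizer_def is_arg_min_def ps_def not_less)
  qed
  moreover have "xs = ps y \<and> v = y" if min: "minimizer L \<phi> (xs, v)" for xs v
  proof -
    have le: "objective L \<phi> (xs, v) \<le> objective L \<phi> (ps w, w)" for w
      using min by (auto simp: minimizer_def is_arg_min_def ps_def not_less)
    \<comment> \<open>Comparison with the candidate fixes the differences \<open>xs l - v\<close>;
      the comparison at \<open>v\<close> itself, below, gives \<open>xs l = T l v\<close>. Together
      they make \<open>T l v - v\<close> agree with \<open>T l y - y\<close>.\<close>
    have d: "\<forall>l\<in>{1..L}. xs l - v - (ps y l - y) = 0"
      using growth[of xs v] le[of y] by (intro zero[of y]) (rule order_trans)
    have "objective L \<phi> (ps v, v) + ereal (1/2 * (\<Sum>l=1..L. (norm (xs l - ps v l))\<^sup>2))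
        \<le> objective L \<phi> (xs, v)"
      using objective_growth[where \<phi> = \<phi> and L = L and ps = "ps v" and y = v and v = v and xs = xs,
          OF pc prox] by simp
    then have e: "\<forall>l\<in>{1..L}. xs l - ps v l = 0"
      using le[of v] by (intro zero[of v]) (rule order_trans)
    have "(\<Sum>l=1..L. T l v - v) = (\<Sum>l=1..L. T l y - y)"
    proof (rule sum.cong)
      fix l assume l: "l \<in> {1..L}"
      then have "xs l = T l v" "xs l - v = T l y - y"
        using d[rule_format, OF l] e[rule_format, OF l] by (simp_all add: ps_def)
      then show "T l v - v = T l y - y" by simp
    qed simp
    then have v: "v = y" using y by (intro y_unique) simp
    have "xs \<in> {1..L} \<rightarrow>\<^sub>E UNIV" using min by (auto simp: minimizer_def is_arg_min_def)
    moreover have "ps y \<in> {1..L} \<rightarrow>\<^sub>E UNIV" by (auto simp: ps_def)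
    ultimately have "xs = ps y"
    proof (rule PiE_ext)
      fix l assume l: "l \<in> {1..L}"
      show "xs l = ps y l" using e[rule_format, OF l] v by simp
    qed
    with v show ?thesis by simp
  qed
  ultimately show ?thesis unfolding ps_def by (cases p) blast
qed

section \<open>Layers\<close>

lemma mat_vec_diff: "mat_vec C A u r - mat_vec C A v r = mat_vec C A (\<lambda>c. u c - v c) r"
  by (simp add: mat_vec_def sum_subtractf right_diff_distrib)

lemma norm_eq_L2_set: "norm (v :: real ^ 'm::finite) = L2_set (($) v) UNIV"
  by (simp add: norm_vec_def L2_set_def)

text \<open>Cauchy-Schwarz in each row gives the Frobenius norm as a crude constant, which serves to
  bound the supremum in \<open>mat_opnorm\<close>.\<close>

lemma L2_set_mat_vec_le:
  fixes A :: "'r \<Rightarrow> 'c \<Rightarrow> real"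
  shows "L2_set (mat_vec C A v) R \<le> L2_set (\<lambda>r. L2_set (A r) C) R * L2_set v C"
proof -
  have "\<bar>mat_vec C A v r\<bar> \<le> L2_set (A r) C * L2_set v C" for r
  proof -
    have "\<bar>mat_vec C A v r\<bar> \<le> (\<Sum>c\<in>C. \<bar>A r c\<bar> * \<bar>v c\<bar>)"
      unfolding mat_vec_def abs_mult[symmetric] by (rule sum_abs)
    also have "\<dots> \<le> L2_set (A r) C * L2_set v C" by (rule L2_set_mult_ineq)
    finally show ?thesis .
  qed
  then have "L2_set (\<lambda>r. \<bar>mat_vec C A v r\<bar>) R \<le> L2_set (\<lambda>r. L2_set (A r) C * L2_set v C) R"
    by (intro L2_set_mono) auto
  then show ?thesis by (simp add: L2_set_def sum_distrib_right[symmetric] power_mult_distrib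
      real_sqrt_mult sum_nonneg)
qed

lemma L2_set_mat_vec_opnorm:
  assumes "finite C"
  shows "L2_set (mat_vec C A v) R \<le> mat_opnorm R C A * L2_set v C"
proof (cases "L2_set v C = 0")
  case True
  then show ?thesis using L2_set_mat_vec_le[of C A v R] by simp
next
  case False
  then have pos: "L2_set v C > 0" using L2_set_nonneg[of v C] by linarith
  have bdd: "bdd_above ((\<lambda>v. L2_set (mat_vec C A v) R) ` {v. L2_set v C \<le> 1})"
  proof (rule bdd_aboveI2)
    fix v assume "v \<in> {v. L2_set v C \<le> 1}"
    then have "L2_set (\<lambda>r. L2_set (A r) C) R * L2_set v C \<le> L2_set (\<lambda>r. L2_set (A r) C) R * 1"
      by (intro mult_left_mono) (auto intro: L2_set_nonneg)
    then show "L2_set (mat_vec C A v) R \<le> L2_set (\<lambda>r. L2_set (A r) C) R"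
      using L2_set_mat_vec_le[of C A v R] by simp
  qed
  let ?s = "inverse (L2_set v C)"
  have "L2_set (\<lambda>c. ?s * v c) C = ?s * L2_set v C"
    using pos by (simp add: L2_set_right_distrib)
  then have "L2_set (mat_vec C A (\<lambda>c. ?s * v c)) R \<le> mat_opnorm R C A"
    unfolding mat_opnorm_def using pos by (intro cSUP_upper bdd) auto
  moreover have "mat_vec C A (\<lambda>c. ?s * v c) = (\<lambda>r. ?s * mat_vec C A v r)"
    by (auto simp: mat_vec_def sum_distrib_left algebra_simps)
  ultimately have "?s * L2_set (mat_vec C A v) R \<le> mat_opnorm R C A"
    using pos by (simp add: L2_set_right_distrib)
  then show ?thesis using pos by (simp add: field_simps)
qed

text \<open>The all-ones vector has positive norm for nonempty \<open>C\<close> and serves as a test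
  vector.\<close>

lemma mat_opnorm_nonneg:
  assumes "finite C"
  shows "0 \<le> mat_opnorm R C A"
proof (cases "C = {}")
  case True
  then show ?thesis by (simp add: mat_opnorm_def mat_vec_def L2_set_def)
next
  case False
  then have "L2_set (\<lambda>_. 1) C > 0" using assms by (simp add: L2_set_def card_gt_0_iff)
  moreover have "0 \<le> mat_opnorm R C A * L2_set (\<lambda>_. 1) C"
    using L2_set_mat_vec_opnorm[OF assms, of A "\<lambda>_. 1" R] L2_set_nonneg order_trans by blast
  ultimately show ?thesis by (simp add: zero_le_mult_iff)
qed

text \<open>With \<open>w\<close> the transpose applied to \<open>u\<close>, the square of the norm
  of \<open>w\<close> is the inner product of \<open>u\<close> with \<open>A w\<close>, hence at
  most \<open>mat_opnorm R C A\<close> times the norms of \<open>u\<close> and \<open>w\<close>; one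
  norm of \<open>w\<close> cancels.\<close>

lemma L2_set_mat_transpose_opnorm:
  assumes "finite C" "finite R"
  shows "L2_set (mat_vec R (mat_transpose A) u) C \<le> mat_opnorm R C A * L2_set u R"
proof -
  let ?w = "mat_vec R (mat_transpose A) u"
  have "(L2_set ?w C)\<^sup>2 = (\<Sum>c\<in>C. ?w c * ?w c)"
    by (simp add: L2_set_def sum_nonneg power2_eq_square)
  also have "\<dots> = (\<Sum>c\<in>C. \<Sum>r\<in>R. u r * (A r c * ?w c))"
    by (subst (2) mat_vec_def) (simp add: mat_transpose_def sum_distrib_left sum_distrib_right ac_simps)
  also have "\<dots> = (\<Sum>r\<in>R. u r * mat_vec C A ?w r)"
    by (subst sum.swap) (simp add: mat_vec_def[of C A] sum_distrib_left)
  also have "\<dots> \<le> (\<Sum>r\<in>R. \<bar>u r\<bar> * \<bar>mat_vec C A ?w r\<bar>)"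
    by (intro sum_mono) (metis abs_ge_self abs_mult)
  also have "\<dots> \<le> L2_set u R * L2_set (mat_vec C A ?w) R" by (rule L2_set_mult_ineq)
  also have "\<dots> \<le> L2_set u R * (mat_opnorm R C A * L2_set ?w C)"
    using assms by (intro mult_left_mono L2_set_mat_vec_opnorm L2_set_nonneg)
  finally have "L2_set ?w C * L2_set ?w C \<le> (mat_opnorm R C A * L2_set u R) * L2_set ?w C"
    by (simp add: power2_eq_square ac_simps)
  moreover have "0 \<le> mat_opnorm R C A * L2_set u R"
    using assms by (intro mult_nonneg_nonneg mat_opnorm_nonneg L2_set_nonneg)
  ultimately show ?thesis
    using L2_set_nonneg[of ?w C] by (cases "L2_set ?w C = 0") auto
qed

text \<open>The matrix acts once directly and once transposed, hence the square; \<sigma> between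
  them is 1-Lipschitz in each coordinate.\<close>

lemma layer_lipschitz:
  fixes z z' :: "real ^ 'm::finite"
  assumes \<sigma>: "\<And>a c. \<bar>\<sigma> a - \<sigma> c\<bar> \<le> \<bar>a - c\<bar>"
  shows "dist (layer n W U b \<sigma> x z) (layer n W U b \<sigma> x z') \<le> (mat_opnorm {1..n} UNIV W)\<^sup>2 * dist z z'"
proof -
  let ?h = "\<lambda>z k. mat_vec UNIV W (($) z) k + mat_vec UNIV U (($) x) k + b k"
  let ?K = "mat_opnorm {1..n} UNIV W"
  have K: "0 \<le> ?K" by (intro mat_opnorm_nonneg) auto
  have "dist (layer n W U b \<sigma> x z) (layer n W U b \<sigma> x z')
      = L2_set (mat_vec {1..n} (mat_transpose W) (\<lambda>k. \<sigma> (?h z k) - \<sigma> (?h z' k))) UNIV"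
    by (simp add: dist_norm norm_eq_L2_set L2_set_def layer_def mat_vec_diff)
  also have "\<dots> \<le> ?K * L2_set (\<lambda>k. \<sigma> (?h z k) - \<sigma> (?h z' k)) {1..n}"
    by (intro L2_set_mat_transpose_opnorm) auto
  also have "L2_set (\<lambda>k. \<sigma> (?h z k) - \<sigma> (?h z' k)) {1..n}
      \<le> L2_set (mat_vec UNIV W (\<lambda>c. z $ c - z' $ c)) {1..n}"
  proof -
    have "\<bar>\<sigma> (?h z k) - \<sigma> (?h z' k)\<bar> \<le> \<bar>mat_vec UNIV W (\<lambda>c. z $ c - z' $ c) k\<bar>" for k
      using \<sigma>[of "?h z k" "?h z' k"] by (simp add: mat_vec_diff)
    then have "L2_set (\<lambda>k. \<bar>\<sigma> (?h z k) - \<sigma> (?h z' k)\<bar>) {1..n}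
        \<le> L2_set (\<lambda>k. \<bar>mat_vec UNIV W (\<lambda>c. z $ c - z' $ c) k\<bar>) {1..n}"
      by (intro L2_set_mono) auto
    then show ?thesis by (simp add: L2_set_def)
  qed
  also have "\<dots> \<le> ?K * L2_set (\<lambda>c. z $ c - z' $ c) UNIV"
    by (intro L2_set_mat_vec_opnorm) auto
  also have "L2_set (\<lambda>c. z $ c - z' $ c) UNIV = dist z z'"
    by (simp add: dist_norm norm_eq_L2_set L2_set_def)
  finally show ?thesis using K by (simp add: mult_left_mono power2_eq_square mult.assoc)
qed

section \<open>The equilibrium equation in block form\<close>

lemma mat_vec_block_diag:
  assumes "i \<in> {1..L}"
  shows "mat_vec (blk_idx L) (block_diag W) v (i, k) = mat_vec UNIV (W i) (\<lambda>c. v (i, c)) k"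
proof -
  have "mat_vec (blk_idx L) (block_diag W) v (i, k)
      = (\<Sum>j=1..L. if i = j then \<Sum>c\<in>UNIV. W i k c * v (j, c) else 0)"
    unfolding mat_vec_def blk_idx_def block_diag_def sum.cartesian_product'
    by (intro sum.cong) auto
  then show ?thesis using assms by (simp add: mat_vec_def)
qed

lemma mat_vec_block_diag_transpose:
  assumes "i \<in> {1..L}"
  shows "mat_vec (row_idx L n) (mat_transpose (block_diag W)) v (i, c)
    = mat_vec {1..n i} (mat_transpose (W i)) (\<lambda>k. v (i, k)) c"
proof -
  have "mat_vec (row_idx L n) (mat_transpose (block_diag W)) v (i, c)
      = (\<Sum>j=1..L. \<Sum>k=1..n j. (if j = i then W j k c else 0) * v (j, k))"
    unfolding mat_vec_def row_idx_def
    by (subst sum.Sigma) (auto simp: mat_transpose_def block_diag_def intro!: sum.cong)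
  also have "\<dots> = (\<Sum>j=1..L. if j = i then \<Sum>k=1..n j. W j k c * v (j, k) else 0)"
    by (intro sum.cong) auto
  finally show ?thesis using assms by (simp add: mat_vec_def mat_transpose_def)
qed

text \<open>After the cyclic shift, the block diagonal matrices let block \<open>i\<close> see only
  its cyclic predecessor.\<close>

lemma equilibrium_iff_blocks:
  fixes z :: "nat \<times> 'm::finite \<Rightarrow> real"
  shows "equilibrium L n W U b \<sigma> x \<alpha> z \<longleftrightarrow> z \<in> blk_idx L \<rightarrow>\<^sub>E UNIV \<and>
     (\<forall>i\<in>{1..L}. let u = blk z (if i = 1 then L else i - 1) in
        blk z i = (1 - \<alpha>) *\<^sub>R u + \<alpha> *\<^sub>R layer (n i) (W i) (U i) (b i) \<sigma> x u)"
proof -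
  have "mat_vec UNIV (vstack U) (($) x) (i, k) = mat_vec UNIV (U i) (($) x) k" for i k
    by (simp add: mat_vec_def vstack_def)
  moreover have "($) (blk z j) = (\<lambda>c. z (j, c))" for j
    by (auto simp: blk_def)
  moreover have "(\<lambda>c. if i = 1 then z (L, c) else z (i - 1, c))
      = (\<lambda>c. z (if i = 1 then L else i - 1, c))" for i
    by auto
  ultimately have block: "(\<forall>c. z (i, c) = \<alpha> * mat_vec (row_idx L n) (mat_transpose (block_diag W))
        (\<lambda>r. \<sigma> (mat_vec (blk_idx L) (block_diag W) (mat_vec (blk_idx L) (cyclic_perm L) z) r
          + mat_vec UNIV (vstack U) (($) x) r + vstack b r)) (i, c)
        + (1 - \<alpha>) * mat_vec (blk_idx L) (cyclic_perm L) z (i, c)) \<longleftrightarrow>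
      (let u = blk z (if i = 1 then L else i - 1) in
        blk z i = (1 - \<alpha>) *\<^sub>R u + \<alpha> *\<^sub>R layer (n i) (W i) (U i) (b i) \<sigma> x u)"
    if "i \<in> {1..L}" for i
    using that
    by (simp only: vec_eq_iff layer_def mat_vec_block_diag mat_vec_block_diag_transpose Let_def
        mat_vec_cyclic_perm) (simp add: vstack_def blk_def add.commute)
  have ball: "(\<forall>p\<in>blk_idx L. Q p) \<longleftrightarrow> (\<forall>i\<in>{1..L}. \<forall>c. Q (i, c))" for Q :: "nat \<times> 'm \<Rightarrow> bool"
    by (auto simp: blk_idx_def)
  show ?thesis
    unfolding equilibrium_def Let_def ball
    by (intro conj_cong refl ball_cong block[unfolded Let_def])
qed

text \<open>The cycle is cut at block \<open>L\<close> and unrolled from there; the instance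
  \<open>i = L\<close> is the fixed point equation.\<close>

lemma equilibrium_iff_relaxed_orbit:
  assumes "L \<ge> 1"
  shows "equilibrium L n W U b \<sigma> x \<alpha> z \<longleftrightarrow> z \<in> blk_idx L \<rightarrow>\<^sub>E UNIV \<and>
     (\<forall>i\<in>{1..L}. blk z i = relaxed_orbit (\<lambda>i. layer (n i) (W i) (U i) (b i) \<sigma> x) \<alpha> (blk z L) i)"
proof -
  let ?T = "\<lambda>i. layer (n i) (W i) (U i) (b i) \<sigma> x"
  let ?o = "relaxed_orbit ?T \<alpha> (blk z L)"
  let ?pred = "\<lambda>i. if i = 1 then L else i - 1 :: nat"
  let ?G = "\<lambda>i u. (1 - \<alpha>) *\<^sub>R u + \<alpha> *\<^sub>R ?T i u"
  have "(\<forall>i\<in>{1..L}. blk z i = ?G i (blk z (?pred i))) \<longleftrightarrow> (\<forall>i\<in>{1..L}. blk z i = ?o i)"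
    (is "?B \<longleftrightarrow> ?O")
  proof
    assume B: ?B
    have *: "blk z i = ?o i" if "1 \<le> i" "i \<le> L" for i
      using that
    proof (induction i rule: nat_induct_at_least)
      case base
      then show ?case using B[rule_format, of 1] by simp
    next
      case (Suc i)
      then show ?case using B[rule_format, of "Suc i"] by simp
    qed
    show ?O by (intro ballI *) simp_all
  next
    assume O: ?O
    show ?B
    proof
      fix i assume i: "i \<in> {1..L}"
      \<comment> \<open>For \<open>i = 1\<close> the predecessor is block \<open>L\<close>, which is
        the orbit's value at 0.\<close>
      have "blk z (?pred i) = ?o (i - 1)"
      proof (cases "i = 1")
        case False
        with i have "i - 1 \<in> {1..L}" by auto
        with O False show ?thesis by (simp only: if_False)
      qed simp
      moreover have "?o i = ?G i (?o (i - 1))"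
        using i by (cases i) auto
      ultimately show "blk z i = ?G i (blk z (?pred i))"
        using O[rule_format, OF i] by simp
    qed
  qed
  then show ?thesis by (simp only: equilibrium_iff_blocks Let_def)
qed

text \<open>Block \<open>L\<close> of an equilibrium is a fixed point and determines all other
  blocks; conversely the orbit of the fixed point fills the blocks.\<close>

lemma equilibrium_ex1:
  assumes "L \<ge> 1"
    and "\<exists>!u. relaxed_orbit (\<lambda>i. layer (n i) (W i) (U i) (b i) \<sigma> x) \<alpha> u L = u"
  shows "\<exists>!z. equilibrium L n W U b \<sigma> x \<alpha> z"
proof -
  let ?o = "relaxed_orbit (\<lambda>i. layer (n i) (W i) (U i) (b i) \<sigma> x) \<alpha>"
  from assms(2) obtain u where u: "?o u L = u" and unique: "\<forall>v. ?o v L = v \<longrightarrow> v = u"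
    by (rule ex1E)
  define z where "z = (\<lambda>p\<in>blk_idx L. ?o u (fst p) $ snd p)"
  have blk: "blk z i = ?o u i" if "i \<in> {1..L}" for i
    using that by (simp add: z_def blk_def blk_idx_def vec_eq_iff)
  show ?thesis
  proof
    have "blk z L = u" using blk[of L] u assms(1) by simp
    moreover have "z \<in> blk_idx L \<rightarrow>\<^sub>E UNIV" by (simp add: z_def)
    ultimately show "equilibrium L n W U b \<sigma> x \<alpha> z"
      using blk unfolding equilibrium_iff_relaxed_orbit[OF assms(1)] by simp
  next
    fix z' assume z': "equilibrium L n W U b \<sigma> x \<alpha> z'"
    note z' = z'[unfolded equilibrium_iff_relaxed_orbit[OF assms(1)]]
    from z' have orbit: "\<forall>i\<in>{1..L}. blk z' i = ?o (blk z' L) i" by (rule conjunct2)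
    have "blk z' L = u" using assms(1) by (intro unique[rule_format] orbit[rule_format, symmetric]) simp
    then have "blk z' i = blk z i" if "i \<in> {1..L}" for i
      using orbit[rule_format, OF that] blk[OF that] by simp
    then have "z' (i, c) = z (i, c)" if "i \<in> {1..L}" for i c
      using that by (simp add: blk_def vec_eq_iff)
    moreover have "z' \<in> blk_idx L \<rightarrow>\<^sub>E UNIV" using z' by (rule conjunct1)
    moreover have "z \<in> blk_idx L \<rightarrow>\<^sub>E UNIV" by (simp add: z_def)
    ultimately show "z' = z"
      by (intro PiE_ext[of _ "blk_idx L"]) (auto simp: blk_idx_def)
  qed
qed

theorem theorem3:
  fixes \<sigma> :: "real \<Rightarrow> real"
    and L :: nat
    and n :: "nat \<Rightarrow> nat"
    and x :: "real ^ 'd"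
    and W :: "nat \<Rightarrow> nat \<Rightarrow> 'm::finite \<Rightarrow> real"
    and U :: "nat \<Rightarrow> nat \<Rightarrow> 'd::finite \<Rightarrow> real"
    and b :: "nat \<Rightarrow> nat \<Rightarrow> real"
    and \<phi> :: "nat \<Rightarrow> real ^ 'm \<Rightarrow> ereal"
  assumes "\<And>a c. a \<noteq> c \<Longrightarrow> 0 \<le> (\<sigma> a - \<sigma> c) / (a - c) \<and> (\<sigma> a - \<sigma> c) / (a - c) \<le> 1"
    and "L \<ge> 1"
    and "\<And>i. i \<in> {1..L} \<Longrightarrow> mat_opnorm {1..n i} UNIV (W i) \<le> 1"
    and "\<exists>i\<in>{1..L}. mat_opnorm {1..n i} UNIV (W i) < 1"
    and "\<And>i. i \<in> {1..L} \<Longrightarrow> proper_convex (\<phi> i)"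
    and "\<And>i z. i \<in> {1..L} \<Longrightarrow> prox (\<phi> i) z = {layer (n i) (W i) (U i) (b i) \<sigma> x z}"
  shows "(\<forall>\<alpha>\<in>{0<..1}. \<exists>!z. equilibrium L n W U b \<sigma> x \<alpha> z) \<and>
         (\<exists>!p. minimizer L \<phi> p) \<and>
         (\<forall>z xs y. (\<forall>\<alpha>\<in>{0<..1}. equilibrium L n W U b \<sigma> x \<alpha> (z \<alpha>)) \<longrightarrow>
            minimizer L \<phi> (xs, y) \<longrightarrow>
            (\<forall>i\<in>{1..L}. ((\<lambda>\<alpha>. blk (z \<alpha>) i) \<longlongrightarrow> y) (at_right 0)))"
proof -
  define T where "T i = layer (n i) (W i) (U i) (b i) \<sigma> x" for i
  define K where "K i = mat_opnorm {1..n i} UNIV (W i)" for i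
  have K: "0 \<le> K i" for i unfolding K_def by (intro mat_opnorm_nonneg) auto
  have "\<bar>\<sigma> a - \<sigma> c\<bar> \<le> \<bar>a - c\<bar>" for a c
    using assms(1)[of a c] by (cases "a = c") (auto simp: divide_simps abs_if split: if_splits)
  then have lip: "dist (T i u) (T i v) \<le> (K i)\<^sup>2 * dist u v" for i u v
    unfolding T_def K_def by (intro layer_lipschitz)
  have ne: "dist (T i u) (T i v) \<le> dist u v" if "i \<in> {1..L}" for i u v
  proof -
    have "(K i)\<^sup>2 \<le> 1" using K assms(3)[OF that] by (simp add: K_def power_le_one)
    then have "(K i)\<^sup>2 * dist u v \<le> 1 * dist u v" by (intro mult_right_mono) auto
    with lip[of i u v] show ?thesis by simp
  qed
  obtain j where j: "j \<in> {1..L}" "K j < 1" using assms(4) by (auto simp: K_def)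
  \<comment> \<open>The Lipschitz constant of a layer is the squared operator norm, so this is the
    contraction constant of layer \<open>j\<close>.\<close>
  have q: "0 \<le> (K j)\<^sup>2" "(K j)\<^sup>2 < 1"
    using K j(2) by (simp_all add: power_less_one_iff)
  have eq: "\<exists>!z. equilibrium L n W U b \<sigma> x \<alpha> z" if "\<alpha> \<in> {0<..1}" for \<alpha>
    using that relaxed_orbit_fixed_point[of \<alpha> "(K j)\<^sup>2" L T j, OF _ _ q ne lip j(1)]
    by (intro equilibrium_ex1 assms(2)) (simp add: T_def[abs_def])
  from average_fixed_point[of "(K j)\<^sup>2" L T j, OF q ne lip j(1)]
  obtain y where y: "(\<Sum>i=1..L. T i y - y) = 0"
    and y_unique: "\<forall>v. (\<Sum>i=1..L. T i v - v) = 0 \<longrightarrow> v = y"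
    by (rule ex1E)
  have "T i u \<in> prox (\<phi> i) u" if "i \<in> {1..L}" for i u
    using assms(6)[OF that] by (simp add: T_def)
  from minimizer_iff[OF assms(5) this y y_unique[rule_format]]
  have min: "minimizer L \<phi> p \<longleftrightarrow> p = (\<lambda>l\<in>{1..L}. T l y, y)" for p .
  have "((\<lambda>\<alpha>. blk (z \<alpha>) i) \<longlongrightarrow> y) (at_right 0)"
    if z: "\<forall>\<alpha>\<in>{0<..1}. equilibrium L n W U b \<sigma> x \<alpha> (z \<alpha>)" and i: "i \<in> {1..L}" for z i
  proof -
    have orbit: "blk (z \<alpha>) k = relaxed_orbit T \<alpha> (blk (z \<alpha>) L) k"
      if "\<alpha> \<in> {0<..1}" "k \<in> {1..L}" for \<alpha> k
      using z that unfolding equilibrium_iff_relaxed_orbit[OF assms(2)] T_def[abs_def] by blast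
    have "((\<lambda>\<alpha>. relaxed_orbit T \<alpha> (blk (z \<alpha>) L) i) \<longlongrightarrow> y) (at_right 0)"
      using i assms(2)
      by (intro relaxed_orbit_fixed_point_tendsto[of "(K j)\<^sup>2" L T j, OF q ne lip j(1) y]
          orbit[symmetric]) auto
    \<comment> \<open>The orbit identity holds for \<alpha> in (0,1], which covers a right
      neighbourhood of 0.\<close>
    moreover have "\<forall>\<^sub>F \<alpha> in at_right 0. relaxed_orbit T \<alpha> (blk (z \<alpha>) L) i = blk (z \<alpha>) i"
      using orbit[OF _ i] by (intro eventually_at_rightI[of 0 1]) auto
    ultimately show ?thesis by (rule Lim_transform_eventually)
  qed
  with eq min show ?thesis by auto
qed

end
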